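(* For positive integers $t,d,r,k$ with $r\ge k$, let $R(t,d,r,k)$ be the smallest integer $R$ such that for any $R$ points in $\mathbb{R}^d$ there is a partition $\mathcal{P}$ of them into $r$ parts with the following property: for any set $C$ of at most $t$ of the points and any $k$-tuple $\mathcal{K}$ of parts of $\mathcal{P}$, even if the points of $C$ are removed, the convex hulls of what is left in each part of $\mathcal{K}$ intersect (the $k$ convex hulls have a common point). Then \[ R(t,d,r,k)=rt+\tilde O\left(r\sqrt{dkrt}+r^2dk\right), \] that is, there are absolute constants $K,m>0$ such that for all positive integers $t,d,r,k$ with $r\ge k$, \[ |R(t,d,r,k)-rt|\le K\left(r\sqrt{dkrt}+r^2dk\right)\left(\ln(2+t+d+r+k)\right)^m . \]
   Context: The notation $\tilde O(\cdot)$ hides an absolute constant and only polylogarithmic factors in the parameters. A $k$-tuple of parts means $k$ different parts of the partition (indexed by $1,\ldots,r$). *)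

theory Defs
  imports "HOL-Analysis.Analysis" "HOL-Analysis.Finite_Function_Topology"
begin

(* The dimension d is quantified inside the statement (the constants must not depend on it),
   so it cannot be a type.  We realise R^d inside the real vector space of finitely supported
   sequences, as the vectors supported on the first d coordinates. *)
definition Rd :: "nat \<Rightarrow> (nat \<Rightarrow>\<^sub>0 real) set" where
  "Rd d = {v. Poly_Mapping.keys v \<subseteq> {..<d}}"

(* The parts are P 1, ..., P r, given as sets of indices of the points x 0, ..., x (N - 1).
   For 1 <= k <= r the condition with C = {} already forces every part to be nonempty. *)
definition tolerant_partition ::
    "nat \<Rightarrow> nat \<Rightarrow> nat \<Rightarrow> nat \<Rightarrow> (nat \<Rightarrow> 'a::real_vector) \<Rightarrow> (nat \<Rightarrow> nat set) \<Rightarrow> bool" where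
  "tolerant_partition t r k N x P \<longleftrightarrow>
     disjoint_family_on P {1..r} \<and> (\<Union>i\<in>{1..r}. P i) = {..<N} \<and>
     (\<forall>C I. C \<subseteq> {..<N} \<and> card C \<le> t \<and> I \<subseteq> {1..r} \<and> card I = k \<longrightarrow>
        (\<Inter>i\<in>I. convex hull (x ` (P i - C))) \<noteq> {})"

(* Points are families, so they may coincide. *)
definition tolerant_number :: "nat \<Rightarrow> nat \<Rightarrow> nat \<Rightarrow> nat \<Rightarrow> nat \<Rightarrow> bool" where
  "tolerant_number t d r k N \<longleftrightarrow>
     (\<forall>x. (\<forall>j<N. x j \<in> Rd d) \<longrightarrow> (\<exists>P. tolerant_partition t r k N x P))"

(* Meaningful only if some N is a tolerant_number. *)
definition tolerant_R :: "nat \<Rightarrow> nat \<Rightarrow> nat \<Rightarrow> nat \<Rightarrow> nat" where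
  "tolerant_R t d r k = (LEAST N. tolerant_number t d r k N)"

end

theory Submission
  imports Defs
begin

text \<open>
  The lower bound \<open>R \<ge> r t\<close> holds because a part with at most \<open>t\<close> points disappears when all of
  its points are removed, so every part has more than \<open>t\<close> points.
  
  For the upper bound each of \<open>N = r (t + M)\<close> points is put into a part chosen uniformly and
  independently at random. With positive probability the resulting partition keeps a point common
  to the hulls of all \<open>r\<close> parts, hence of any \<open>k\<close> of them, after the removal of any \<open>t\<close> points.
  The argument has four ingredients.
  
  \<^item> By linear programming duality (\<open>gordan_alternative\<close>), finite sets \<open>A\<^sub>1, \<dots>, A\<^sub>r\<close> have hulls
    without a common point only if there are affine functionals \<open>F\<^sub>i\<close> with sum zero such that \<open>F\<^sub>i\<close> is
    positive on \<open>A\<^sub>i\<close> (\<open>disjoint_hulls_separation\<close>). As the sum is zero, every point \<open>x\<close> satisfies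
    \<open>F\<^sub>i x \<le> 0\<close> for some \<open>i\<close>. Call \<open>x\<close> a blocker of the tuple \<open>F\<close> if \<open>F\<^sub>i x \<le> 0\<close> for the index
    \<open>i\<close> of its own part. If every tuple has more than \<open>t\<close> blockers, then a blocker survives each
    removal of \<open>t\<close> points, and no tuple separates what is left of the parts.
  
  \<^item> Only the sets \<open>{j. F\<^sub>i (x j) \<le> 0}\<close> matter. By the Sauer-Shelah lemma there are at most
    \<open>(N + 1)\<^bsup>d + 1\<^esup>\<close> of them for each \<open>i\<close> (\<open>card_halfspace_traces_le\<close>), and so at most
    \<open>(N + 1)\<^bsup>(d + 1) r\<^esup>\<close> tuples.
  
  \<^item> A fixed tuple has each point as a blocker with probability at least \<open>1/r\<close>, independently. The
    expected number of blockers is at least \<open>t + M\<close>, and the multiplicative Chernoff bound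
    (\<open>card_few_agreements_le\<close>) shows that there are at most \<open>t\<close> of them with probability at most
    \<open>exp (- M\<^sup>2 / (2 (t + M)))\<close>.
  
  \<^item> A union bound over the tuples leaves a good partition as soon as \<open>M\<^sup>2 / (t + M)\<close> exceeds about
    \<open>r d ln N\<close>, that is, for \<open>M\<close> of order \<open>sqrt (r d t) + r d\<close> up to logarithms. Then
    \<open>N - r t = r M\<close>. The multiplicative form of the Chernoff bound, whose variance term is \<open>N / r\<close>
    rather than \<open>N\<close>, saves a factor \<open>sqrt r\<close>. It makes up for treating all \<open>r\<close> parts at once instead
    of \<open>k\<close> of them.
\<close>

section \<open>Affine functionals separating disjoint hulls\<close>

text \<open>
  Gordan's theorem, phrased for a linear space \<open>V\<close> of real functions on the finite set \<open>J\<close>, so that no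
  ambient vector space is fixed. Induction on \<open>J\<close>: let \<open>w \<in> V\<close> be positive on \<open>J\<close> and consider a new
  index \<open>n\<close>. If \<open>w n = 0\<close>, a small multiple of a function positive at \<open>n\<close> can be added to \<open>w\<close>. If
  \<open>w n < 0\<close>, adding multiples of \<open>w\<close> brings every function of \<open>V\<close> to value \<open>0\<close> at \<open>n\<close>, and the
  induction hypothesis is applied to the space of the functions so obtained.
\<close>

lemma gordan_alternative:
  fixes V :: "('j \<Rightarrow> real) set"
  assumes "finite J"
    and "\<And>v w. v \<in> V \<Longrightarrow> w \<in> V \<Longrightarrow> (\<lambda>j. v j + w j) \<in> V"
    and "\<And>v s. v \<in> V \<Longrightarrow> (\<lambda>j. s * v j) \<in> V"
    and "V \<noteq> {}"
  shows "(\<exists>v\<in>V. \<forall>j\<in>J. v j > 0) \<or>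
    (\<exists>c. (\<forall>j\<in>J. c j \<ge> 0) \<and> (\<exists>j\<in>J. c j > 0) \<and> (\<forall>v\<in>V. (\<Sum>j\<in>J. c j * v j) = 0))"
  using assms
proof (induction J arbitrary: V rule: finite_induct)
  case empty
  then show ?case by auto
next
  case (insert n J)
  note add = insert.prems(1) and scale = insert.prems(2)
  have extend: ?case if w: "w \<in> V" "w n = 0" "\<forall>j\<in>J. w j > 0" for w
  proof (cases "\<exists>u\<in>V. u n \<noteq> 0")
    case False
    have "(\<Sum>j\<in>insert n J. (if j = n then 1 else 0) * v j) = 0" if "v \<in> V" for v
    proof -
      have "(\<Sum>j\<in>J. (if j = n then 1 else 0) * v j) = 0"
        using insert.hyps by (intro sum.neutral) auto
      then show ?thesis using insert.hyps False that by simp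
    qed
    then show ?thesis
      by (intro disjI2 exI[of _ "\<lambda>j. if j = n then 1 else 0"] conjI) simp_all
  next
    case True
    then obtain u0 where u0: "u0 \<in> V" "u0 n \<noteq> 0" by blast
    define u where "u = (\<lambda>j. u0 n * u0 j)"
    have u: "u \<in> V" "u n > 0"
      using scale[OF u0(1)] u0(2) by (auto simp: u_def zero_less_mult_iff linorder_neq_iff)
    \<comment> \<open>A small enough positive multiple of \<open>u\<close> keeps the values on \<open>J\<close> positive.\<close>
    have "\<forall>\<^sub>F s in at_right (0::real). w j + s * u j > 0" if "j \<in> J" for j
    proof -
      have "((\<lambda>s. w j + s * u j) \<longlongrightarrow> w j + 0 * u j) (at_right 0)"
        by (intro tendsto_intros)
      then show ?thesis using w(3) that by (intro order_tendstoD(1)) auto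
    qed
    then have "\<forall>\<^sub>F s in at_right (0::real). \<forall>j\<in>J. w j + s * u j > 0"
      using insert.hyps(1) by (simp add: eventually_ball_finite)
    then have "\<forall>\<^sub>F s in at_right (0::real). (\<forall>j\<in>J. w j + s * u j > 0) \<and> s > 0"
      by (intro eventually_conj) (auto simp: eventually_at_right_less)
    then obtain s :: real where s: "\<forall>j\<in>J. w j + s * u j > 0" "s > 0"
      using eventually_happens'[OF trivial_limit_at_right_real] by (metis (no_types, lifting))
    have "(\<lambda>j. w j + s * u j) \<in> V" by (intro add w scale u)
    moreover have "\<forall>j\<in>insert n J. w j + s * u j > 0" using s w(2) u(2) by simp
    ultimately show ?thesis by (intro disjI1 bexI)
  qed
  consider (pos) "\<exists>v\<in>V. \<forall>j\<in>J. v j > 0"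
    | (dep) "\<exists>c. (\<forall>j\<in>J. c j \<ge> 0) \<and> (\<exists>j\<in>J. c j > 0) \<and> (\<forall>v\<in>V. (\<Sum>j\<in>J. c j * v j) = 0)"
    using insert.IH[OF insert.prems] by blast
  then show ?case
  proof cases
    case dep
    then obtain c where c: "\<forall>j\<in>J. c j \<ge> 0" "\<exists>j\<in>J. c j > 0"
      "\<forall>v\<in>V. (\<Sum>j\<in>J. c j * v j) = 0" by blast
    have "(\<Sum>j\<in>insert n J. (c(n := 0)) j * v j) = (\<Sum>j\<in>J. c j * v j)" for v
      using insert.hyps by (auto intro!: sum.cong)
    moreover have "\<exists>j\<in>insert n J. (c(n := 0)) j > 0" using c(2) insert.hyps by force
    moreover have "\<forall>j\<in>insert n J. (c(n := 0)) j \<ge> 0" using c(1) by simp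
    ultimately show ?thesis
      using c(3) by (intro disjI2 exI[of _ "c(n := 0)"] conjI) simp_all
  next
    case pos
    then obtain w where w: "w \<in> V" "\<forall>j\<in>J. w j > 0" by blast
    consider "w n > 0" | "w n = 0" | "w n < 0" by linarith
    then show ?thesis
    proof cases
      case 1
      then show ?thesis using w by blast
    next
      case 2
      then show ?thesis using extend w by blast
    next
      case 3
      define q where "q j = - w j / w n" for j
      have q: "q j > 0" if "j \<in> J" for j
        using w(2) 3 that by (simp add: q_def divide_pos_neg)
      \<comment> \<open>On \<open>J\<close>, \<open>T v\<close> agrees with \<open>v - (v n / w n) w\<close>, the projection of \<open>v\<close> along \<open>w\<close> to value \<open>0\<close>
         at \<open>n\<close>.\<close>
      define T where "T v = (\<lambda>j. v j + q j * v n)" for v :: "'j \<Rightarrow> real"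
      have "(\<exists>v\<in>T ` V. \<forall>j\<in>J. v j > 0) \<or> (\<exists>c. (\<forall>j\<in>J. c j \<ge> 0) \<and> (\<exists>j\<in>J. c j > 0) \<and>
          (\<forall>v\<in>T ` V. (\<Sum>j\<in>J. c j * v j) = 0))"
      proof (rule insert.IH)
        show "(\<lambda>j. v j + w j) \<in> T ` V" if "v \<in> T ` V" "w \<in> T ` V" for v w
        proof -
          obtain v' w' where "v' \<in> V" "v = T v'" "w' \<in> V" "w = T w'" using \<open>v \<in> T ` V\<close> \<open>w \<in> T ` V\<close> by blast
          then show ?thesis
            by (intro image_eqI[of _ _ "\<lambda>j. v' j + w' j"] add) (auto simp: T_def algebra_simps)
        qed
        show "(\<lambda>j. s * v j) \<in> T ` V" if "v \<in> T ` V" for v s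
        proof -
          obtain v' where "v' \<in> V" "v = T v'" using \<open>v \<in> T ` V\<close> by blast
          then show ?thesis
            by (intro image_eqI[of _ _ "\<lambda>j. s * v' j"] scale) (auto simp: T_def algebra_simps)
        qed
        show "T ` V \<noteq> {}" using insert.prems by simp
      qed
      then show ?thesis
      proof
        assume "\<exists>v\<in>T ` V. \<forall>j\<in>J. v j > 0"
        then obtain v where v: "v \<in> V" "\<forall>j\<in>J. v j + q j * v n > 0" by (auto simp: T_def)
        define v' where "v' = (\<lambda>j. v j + (- v n / w n) * w j)"
        have "v' \<in> V" unfolding v'_def by (intro add scale v w)
        moreover have "v' n = 0" using 3 by (simp add: v'_def)
        moreover have "v' j = v j + q j * v n" for j by (simp add: v'_def q_def)
        ultimately show ?thesis using extend v(2) by simp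
      next
        assume "\<exists>c. (\<forall>j\<in>J. c j \<ge> 0) \<and> (\<exists>j\<in>J. c j > 0) \<and> (\<forall>v\<in>T ` V. (\<Sum>j\<in>J. c j * v j) = 0)"
        then obtain c where c: "\<forall>j\<in>J. c j \<ge> 0" "\<exists>j\<in>J. c j > 0"
          "\<And>v. v \<in> V \<Longrightarrow> (\<Sum>j\<in>J. c j * (v j + q j * v n)) = 0" by (auto simp: T_def)
        \<comment> \<open>The weight at \<open>n\<close> absorbs the multiples of \<open>v n\<close> that \<open>T\<close> adds on \<open>J\<close>.\<close>
        define c' where "c' = c(n := (\<Sum>j\<in>J. c j * q j))"
        have "(\<Sum>j\<in>insert n J. c' j * v j) = (\<Sum>j\<in>J. c j * (v j + q j * v n))" for v
        proof -
          have "(\<Sum>j\<in>J. c' j * v j) = (\<Sum>j\<in>J. c j * v j)"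
            using insert.hyps by (intro sum.cong) (auto simp: c'_def)
          then show ?thesis
            using insert.hyps
            by (simp add: c'_def sum.distrib sum_distrib_right distrib_left mult.assoc)
        qed
        moreover have "c' n \<ge> 0"
          unfolding c'_def fun_upd_same
          using c(1) q by (intro sum_nonneg mult_nonneg_nonneg) (simp_all add: less_imp_le)
        then have "\<forall>j\<in>insert n J. c' j \<ge> 0" using c(1) by (simp add: c'_def)
        moreover have "\<exists>j\<in>insert n J. c' j > 0" using c(2) insert.hyps by (force simp: c'_def)
        ultimately show ?thesis
          using c(3) by (intro disjI2 exI[of _ c'] conjI) simp_all
      qed
    qed
  qed
qed

definition affine_functionals :: "nat \<Rightarrow> ((nat \<Rightarrow>\<^sub>0 real) \<Rightarrow> real) set" where
  "affine_functionals d = {f. \<exists>a b. f = (\<lambda>x. b + (\<Sum>l<d. a l * Poly_Mapping.lookup x l))}"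

lemma affine_functionals_add:
  assumes "f \<in> affine_functionals d" "g \<in> affine_functionals d"
  shows "(\<lambda>x. f x + g x) \<in> affine_functionals d"
proof -
  from assms obtain a b a' b' where "f = (\<lambda>x. b + (\<Sum>l<d. a l * Poly_Mapping.lookup x l))"
    "g = (\<lambda>x. b' + (\<Sum>l<d. a' l * Poly_Mapping.lookup x l))"
    by (auto simp: affine_functionals_def)
  then have eq: "(\<lambda>x. f x + g x) = (\<lambda>x. (b + b') + (\<Sum>l<d. (a l + a' l) * Poly_Mapping.lookup x l))"
    by (simp add: sum.distrib distrib_right fun_eq_iff)
  show ?thesis unfolding affine_functionals_def by (rule CollectI, intro exI, rule eq)
qed

lemma affine_functionals_scale:
  assumes "f \<in> affine_functionals d"
  shows "(\<lambda>x. s * f x) \<in> affine_functionals d"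
proof -
  from assms obtain a b where "f = (\<lambda>x. b + (\<Sum>l<d. a l * Poly_Mapping.lookup x l))"
    by (auto simp: affine_functionals_def)
  then have eq: "(\<lambda>x. s * f x) = (\<lambda>x. s * b + (\<Sum>l<d. (s * a l) * Poly_Mapping.lookup x l))"
    by (simp add: sum_distrib_left distrib_left mult.assoc fun_eq_iff)
  show ?thesis unfolding affine_functionals_def by (rule CollectI, intro exI, rule eq)
qed

lemma affine_functionals_const: "(\<lambda>x. b) \<in> affine_functionals d"
  unfolding affine_functionals_def by (auto intro!: exI[of _ "\<lambda>_. 0"] exI[of _ b])

lemma affine_functionals_coordinate:
  assumes "l < d"
  shows "(\<lambda>x. Poly_Mapping.lookup x l) \<in> affine_functionals d"
proof -
  have eq: "(\<lambda>x :: nat \<Rightarrow>\<^sub>0 real. Poly_Mapping.lookup x l)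
      = (\<lambda>x. 0 + (\<Sum>i<d. (if i = l then 1 else 0) * Poly_Mapping.lookup x i))"
  proof
    fix x :: "nat \<Rightarrow>\<^sub>0 real"
    have "(\<Sum>i<d. (if i = l then 1 else 0) * Poly_Mapping.lookup x i)
        = (\<Sum>i<d. if i = l then Poly_Mapping.lookup x i else 0)"
      by (intro sum.cong) auto
    also have "\<dots> = Poly_Mapping.lookup x l" using assms by simp
    finally show "Poly_Mapping.lookup x l
        = 0 + (\<Sum>i<d. (if i = l then 1 else 0) * Poly_Mapping.lookup x i)"
      by (simp only: add_0)
  qed
  show ?thesis unfolding affine_functionals_def by (rule CollectI, intro exI, rule eq)
qed

lemma lookup_scaleR:
  fixes x :: "'a \<Rightarrow>\<^sub>0 real"
  shows "Poly_Mapping.lookup (s *\<^sub>R x) i = s * Poly_Mapping.lookup x i"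
proof -
  have "finite {i. s * Poly_Mapping.lookup x i \<noteq> 0}"
    by (rule finite_subset[OF _ finite_lookup[of x]]) auto
  then show ?thesis by (simp add: scaleR_poly_mapping_def)
qed

text \<open>
  Gordan's alternative is applied on the disjoint union of the sets \<open>A i\<close>, to the space of all tuples
  of affine functionals with sum zero. A nonnegative dependency \<open>c\<close> has to be orthogonal to the tuples
  with \<open>h\<close> in place \<open>i\<close>, \<open>- h\<close> in place \<open>i'\<close> and zeros elsewhere. So the weighted sums
  of \<open>h\<close> over \<open>A i\<close> do not depend on \<open>i\<close>. With \<open>h\<close> constant this gives equal total weights, with \<open>h\<close> a
  coordinate it gives equal barycentres, and the common barycentre lies in all hulls.
\<close>

lemma disjoint_hulls_separation:
  fixes A :: "'i \<Rightarrow> (nat \<Rightarrow>\<^sub>0 real) set"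
  assumes I: "finite I" "I \<noteq> {}" and A: "\<And>i. i \<in> I \<Longrightarrow> finite (A i) \<and> A i \<subseteq> Rd d"
    and disj: "(\<Inter>i\<in>I. convex hull A i) = {}"
  obtains F where "\<And>i. i \<in> I \<Longrightarrow> F i \<in> affine_functionals d"
    "\<And>x. (\<Sum>i\<in>I. F i x) = 0" "\<And>i x. i \<in> I \<Longrightarrow> x \<in> A i \<Longrightarrow> F i x > 0"
proof -
  define G where "G = {F. (\<forall>i\<in>I. F i \<in> affine_functionals d) \<and> (\<forall>x. (\<Sum>i\<in>I. F i x) = 0)}"
  define V where "V = case_prod ` G"
  define J where "J = Sigma I A"
  have "finite J" using I A by (auto simp: J_def)
  then have "(\<exists>v\<in>V. \<forall>j\<in>J. v j > 0) \<or>
    (\<exists>c. (\<forall>j\<in>J. c j \<ge> 0) \<and> (\<exists>j\<in>J. c j > 0) \<and> (\<forall>v\<in>V. (\<Sum>j\<in>J. c j * v j) = 0))"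
  proof (rule gordan_alternative)
    show "(\<lambda>j. v j + w j) \<in> V" if vw: "v \<in> V" "w \<in> V" for v w
    proof -
      obtain F F' where F: "F \<in> G" "v = case_prod F" "F' \<in> G" "w = case_prod F'"
        using vw by (auto simp: V_def)
      then have "(\<lambda>i x. F i x + F' i x) \<in> G"
        by (auto simp: G_def sum.distrib affine_functionals_add)
      then show ?thesis unfolding V_def F by (rule rev_image_eqI) auto
    qed
    show "(\<lambda>j. s * v j) \<in> V" if v: "v \<in> V" for v s
    proof -
      obtain F where F: "F \<in> G" "v = case_prod F" using v by (auto simp: V_def)
      then have "(\<lambda>i x. s * F i x) \<in> G"
        by (auto simp: G_def affine_functionals_scale simp flip: sum_distrib_left)
      then show ?thesis unfolding V_def F by (rule rev_image_eqI) auto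
    qed
    have "(\<lambda>i x. 0) \<in> G" by (simp add: G_def affine_functionals_const)
    then show "V \<noteq> {}" unfolding V_def by blast
  qed
  then show thesis
  proof
    assume "\<exists>v\<in>V. \<forall>j\<in>J. v j > 0"
    then obtain F where "F \<in> G" "\<forall>j\<in>J. case_prod F j > 0" unfolding V_def by blast
    then show thesis by (intro that[of F]) (auto simp: G_def J_def)
  next
    assume "\<exists>c. (\<forall>j\<in>J. c j \<ge> 0) \<and> (\<exists>j\<in>J. c j > 0) \<and> (\<forall>v\<in>V. (\<Sum>j\<in>J. c j * v j) = 0)"
    then obtain c where c: "\<And>j. j \<in> J \<Longrightarrow> c j \<ge> 0" "\<exists>j\<in>J. c j > 0"
      "\<And>v. v \<in> V \<Longrightarrow> (\<Sum>j\<in>J. c j * v j) = 0" by blast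
    have dep: "(\<Sum>i\<in>I. \<Sum>x\<in>A i. c (i, x) * F i x) = 0" if "F \<in> G" for F
    proof -
      have "(\<Sum>i\<in>I. \<Sum>x\<in>A i. c (i, x) * F i x) = (\<Sum>j\<in>J. c j * case_prod F j)"
        unfolding J_def using I A by (subst sum.Sigma) (auto simp: case_prod_beta)
      then show ?thesis using c(3)[of "case_prod F"] that by (simp add: V_def)
    qed
    have same: "(\<Sum>x\<in>A i. c (i, x) * h x) = (\<Sum>x\<in>A i'. c (i', x) * h x)"
      if ii: "i \<in> I" "i' \<in> I" and h: "h \<in> affine_functionals d" for i i' h
    proof (cases "i = i'")
      case False
      define F where "F j x = (if j = i then h x else 0) + (if j = i' then - 1 * h x else 0)" for j x
      have "F \<in> G" unfolding G_def
      proof (intro CollectI conjI ballI allI)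
        show "F j \<in> affine_functionals d" if "j \<in> I" for j
        proof -
          have "F j = (if j = i then h else if j = i' then (\<lambda>x. - 1 * h x) else (\<lambda>x. 0))"
            using False by (auto simp: F_def fun_eq_iff)
          then show ?thesis
            using h affine_functionals_scale[OF h, of "- 1"] by (simp add: affine_functionals_const)
        qed
        show "(\<Sum>j\<in>I. F j x) = 0" for x
          unfolding F_def using I ii by (simp add: sum.distrib)
      qed
      then have "0 = (\<Sum>j\<in>I. \<Sum>x\<in>A j. c (j, x) * F j x)" using dep by simp
      also have "\<dots> = (\<Sum>j\<in>I. (if j = i then \<Sum>x\<in>A i. c (i, x) * h x else 0)
          + (if j = i' then - (\<Sum>x\<in>A i'. c (i', x) * h x) else 0))"
        unfolding F_def using False by (intro sum.cong) (auto simp: sum_negf)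
      also have "\<dots> = (\<Sum>x\<in>A i. c (i, x) * h x) - (\<Sum>x\<in>A i'. c (i', x) * h x)"
        using I ii by (simp add: sum.distrib)
      finally show ?thesis by simp
    qed simp
    obtain i0 x0 where i0: "i0 \<in> I" "x0 \<in> A i0" "c (i0, x0) > 0"
      using c(2) by (auto simp: J_def)
    define m where "m = (\<Sum>x\<in>A i0. c (i0, x))"
    define p where "p i = (\<Sum>x\<in>A i. (c (i, x) / m) *\<^sub>R x)" for i
    have m: "(\<Sum>x\<in>A i. c (i, x)) = m" if "i \<in> I" for i
      using same[OF that i0(1) affine_functionals_const[of 1]] by (simp add: m_def)
    have m0: "m > 0" unfolding m_def
      using i0 A c(1) by (intro sum_pos2[of _ x0]) (auto simp: J_def)
    have hull: "p i \<in> convex hull A i" if i: "i \<in> I" for i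
      unfolding p_def
    proof (rule convex_sum)
      show "(\<Sum>x\<in>A i. c (i, x) / m) = 1" using m[OF i] m0 by (simp flip: sum_divide_distrib)
      show "c (i, x) / m \<ge> 0" if "x \<in> A i" for x
        using that i m0 c(1)[of "(i, x)"] by (simp add: J_def)
      show "x \<in> convex hull A i" if "x \<in> A i" for x using that by (rule hull_inc)
    qed (simp_all add: A[OF i] convex_convex_hull)
    have lookup_p: "Poly_Mapping.lookup (p i) l = (\<Sum>x\<in>A i. c (i, x) * Poly_Mapping.lookup x l) / m" for i l
      by (simp add: p_def lookup_sum lookup_scaleR sum_divide_distrib)
    have p_eq: "p i = p i0" if i: "i \<in> I" for i
    proof (rule poly_mapping_eqI)
      fix l
      show "Poly_Mapping.lookup (p i) l = Poly_Mapping.lookup (p i0) l"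
      proof (cases "l < d")
        case True
        then show ?thesis unfolding lookup_p
          by (simp only: same[OF i i0(1) affine_functionals_coordinate])
      next
        case False
        have "(\<Sum>x\<in>A j. c (j, x) * Poly_Mapping.lookup x l) = 0" if "j \<in> I" for j
        proof (intro sum.neutral ballI)
          fix x assume "x \<in> A j"
          then have "Poly_Mapping.keys x \<subseteq> {..<d}" using A[OF that] by (auto simp: Rd_def)
          then have "l \<notin> Poly_Mapping.keys x" using False by auto
          then show "c (j, x) * Poly_Mapping.lookup x l = 0" by (simp add: in_keys_iff)
        qed
        then show ?thesis unfolding lookup_p by (simp only: i i0(1))
      qed
    qed
    have "p i0 \<in> convex hull A i" if "i \<in> I" for i
      using hull[OF that] by (simp only: p_eq[OF that])
    then have "p i0 \<in> (\<Inter>i\<in>I. convex hull A i)" by blast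
    then show thesis using disj by simp
  qed
qed

section \<open>The number of traces of halfspaces on a finite family of points\<close>

definition shatters :: "'a set set \<Rightarrow> 'a set \<Rightarrow> bool" where
  "shatters F B \<longleftrightarrow> (\<forall>T. T \<subseteq> B \<longrightarrow> (\<exists>A\<in>F. A \<inter> B = T))"

text \<open>
  Pajor's form of the Sauer-Shelah lemma: a family shatters at least as many sets as it has members.
  Removing an element \<open>a\<close> of the ground set splits \<open>F\<close> into the members \<open>F0\<close> without \<open>a\<close> and the traces
  \<open>F1\<close> of those with \<open>a\<close>. Sets shattered by \<open>F0 \<union> F1\<close> are shattered by \<open>F\<close>, and so are the sets
  shattered by \<open>F0 \<inter> F1\<close> with \<open>a\<close> added to them.
\<close>

lemma card_le_card_shattered:
  assumes "finite X" "F \<subseteq> Pow X"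
  shows "card F \<le> card {B. B \<subseteq> X \<and> shatters F B}"
  using assms
proof (induction X arbitrary: F rule: finite_induct)
  case empty
  show ?case
  proof (cases "F = {}")
    case False
    with empty have "F = {{}}" by (simp add: subset_singleton_iff)
    then have "{B. B \<subseteq> {} \<and> shatters F B} = {{}}" by (auto simp: shatters_def)
    then show ?thesis using \<open>F = {{}}\<close> by simp
  qed simp
next
  case (insert a X)
  define F0 where "F0 = {A \<in> Pow X. A \<in> F}"
  define F1 where "F1 = {A \<in> Pow X. insert a A \<in> F}"
  have fin: "finite F0" "finite F1" using insert.hyps by (auto simp: F0_def F1_def)
  have "F = F0 \<union> insert a ` F1"
  proof (intro equalityI subsetI)
    fix A assume A: "A \<in> F"
    show "A \<in> F0 \<union> insert a ` F1"
    proof (cases "a \<in> A")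
      case True
      then have "insert a (A - {a}) = A" by blast
      moreover have "A - {a} \<subseteq> X" using A insert.prems by blast
      ultimately show ?thesis using A by (intro UnI2 image_eqI[of _ _ "A - {a}"]) (auto simp: F1_def)
    next
      case False
      then show ?thesis using A insert.prems by (auto simp: F0_def)
    qed
  qed (auto simp: F0_def F1_def)
  moreover have "card (insert a ` F1) = card F1"
  proof (rule card_image, rule inj_onI)
    fix A B assume "A \<in> F1" "B \<in> F1" "insert a A = insert a B"
    moreover have "a \<notin> A" "a \<notin> B" using calculation insert.hyps by (auto simp: F1_def)
    ultimately show "A = B" by (simp add: insert_ident)
  qed
  ultimately have "card F \<le> card F0 + card F1" by (metis card_Un_le)
  also have "\<dots> = card (F0 \<union> F1) + card (F0 \<inter> F1)" using fin by (rule card_Un_Int)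
  also have "\<dots> \<le> card {B. B \<subseteq> X \<and> shatters (F0 \<union> F1) B} + card {B. B \<subseteq> X \<and> shatters (F0 \<inter> F1) B}"
    by (intro add_mono insert.IH) (auto simp: F0_def F1_def)
  also have "\<dots> = card {B. B \<subseteq> X \<and> shatters (F0 \<union> F1) B}
      + card (insert a ` {B. B \<subseteq> X \<and> shatters (F0 \<inter> F1) B})"
    (is "_ = card ?S + card (insert a ` ?T)")
  proof -
    have "inj_on (insert a) ?T"
    proof (rule inj_onI)
      fix A B assume "A \<in> ?T" "B \<in> ?T" "insert a A = insert a B"
      moreover have "a \<notin> A" "a \<notin> B" using calculation insert.hyps by auto
      ultimately show "A = B" by (simp add: insert_ident)
    qed
    then show ?thesis by (simp add: card_image)
  qed
  also have "\<dots> = card (?S \<union> insert a ` ?T)"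
    using insert.hyps by (intro card_Un_disjoint[symmetric]) auto
  also have "\<dots> \<le> card {B. B \<subseteq> insert a X \<and> shatters F B}"
  proof (rule card_mono)
    show "finite {B. B \<subseteq> insert a X \<and> shatters F B}" using insert.hyps by simp
    have "shatters F B" if B: "B \<subseteq> X" "shatters (F0 \<union> F1) B" for B
      unfolding shatters_def
    proof (intro allI impI)
      fix T assume "T \<subseteq> B"
      then obtain A where A: "A \<in> F0 \<union> F1" "A \<inter> B = T"
        using B(2) unfolding shatters_def by blast
      have "insert a A \<inter> B = T" using A B insert.hyps by auto
      moreover have "A \<in> F \<or> insert a A \<in> F" using A(1) by (auto simp: F0_def F1_def)
      ultimately show "\<exists>A\<in>F. A \<inter> B = T" using A(2) by blast
    qed
    moreover have "shatters F (insert a B)" if B: "B \<subseteq> X" "shatters (F0 \<inter> F1) B" for B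
      unfolding shatters_def
    proof (intro allI impI)
      fix T assume T: "T \<subseteq> insert a B"
      then have "T - {a} \<subseteq> B" by blast
      then obtain A where A: "A \<in> F0 \<inter> F1" "A \<inter> B = T - {a}"
        using B(2) unfolding shatters_def by blast
      then have "A \<in> F" "insert a A \<in> F" "a \<notin> A" "a \<notin> B"
        using insert.hyps B by (auto simp: F0_def F1_def)
      moreover have "A \<inter> insert a B = T" if "a \<notin> T" using that A \<open>a \<notin> A\<close> by blast
      moreover have "insert a A \<inter> insert a B = T" if "a \<in> T" using that A by blast
      ultimately show "\<exists>A\<in>F. A \<inter> insert a B = T" by blast
    qed
    ultimately show "?S \<union> insert a ` ?T \<subseteq> {B. B \<subseteq> insert a X \<and> shatters F B}" by auto
  qed
  finally show ?case .
qed

lemma card_small_subsets_le: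
  assumes "finite X"
  shows "card {B. B \<subseteq> X \<and> card B \<le> n} \<le> (card X + 1) ^ n"
proof (induction n)
  case 0
  have "{B. B \<subseteq> X \<and> card B \<le> 0} = {{}}"
    using assms finite_subset by (auto simp: card_eq_0_iff)
  then show ?case by simp
next
  case (Suc n)
  let ?S = "\<lambda>n. {B. B \<subseteq> X \<and> card B \<le> n}"
  define E where "E = insert {} ((\<lambda>a. {a}) ` X)"
  have fin: "finite E" "finite (?S n)" using assms by (auto simp: E_def)
  have "?S (Suc n) \<subseteq> (\<lambda>(e, B). e \<union> B) ` (E \<times> ?S n)"
  proof
    fix B assume B: "B \<in> ?S (Suc n)"
    then have fB: "finite B" using assms finite_subset by blast
    show "B \<in> (\<lambda>(e, B). e \<union> B) ` (E \<times> ?S n)"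
    proof (cases "B = {}")
      case True
      then show ?thesis by (intro image_eqI[of _ _ "({}, {})"]) (auto simp: E_def)
    next
      case False
      then obtain a where a: "a \<in> B" by blast
      then show ?thesis using B fB
        by (intro image_eqI[of _ _ "({a}, B - {a})"]) (auto simp: E_def)
    qed
  qed
  then have "card (?S (Suc n)) \<le> card (E \<times> ?S n)"
    using fin by (intro surj_card_le) auto
  also have "\<dots> \<le> (card X + 1) * (card X + 1) ^ n"
    unfolding card_cartesian_product
  proof (rule mult_mono[OF _ Suc.IH])
    show "card E \<le> card X + 1"
      unfolding E_def using assms card_image_le[OF assms, of "\<lambda>a. {a}"]
      by (simp add: card_insert_if)
  qed auto
  finally show ?case by simp
qed

lemma sauer_shelah:
  assumes "finite X" "F \<subseteq> Pow X" and "\<And>B. B \<subseteq> X \<Longrightarrow> shatters F B \<Longrightarrow> card B \<le> n"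
  shows "card F \<le> (card X + 1) ^ n"
proof -
  have "card F \<le> card {B. B \<subseteq> X \<and> shatters F B}"
    by (rule card_le_card_shattered[OF assms(1,2)])
  also have "\<dots> \<le> card {B. B \<subseteq> X \<and> card B \<le> n}"
    using assms by (intro card_mono) auto
  also have "\<dots> \<le> (card X + 1) ^ n" by (rule card_small_subsets_le[OF assms(1)])
  finally show ?thesis .
qed

text \<open>
  Gaussian elimination. The vectors form a family, not a set, as points may coincide.
\<close>

lemma linear_dependence:
  fixes y :: "'j \<Rightarrow> nat \<Rightarrow> real"
  assumes "finite J" "card J > n"
  shows "\<exists>c. (\<exists>j\<in>J. c j \<noteq> 0) \<and> (\<forall>i<n. (\<Sum>j\<in>J. c j * y j i) = 0)"
  using assms
proof (induction n arbitrary: J y)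
  case 0
  then have "J \<noteq> {}" by auto
  then show ?case by (intro exI[of _ "\<lambda>_. 1"]) auto
next
  case (Suc n)
  show ?case
  proof (cases "\<exists>j0\<in>J. y j0 n \<noteq> 0")
    case False
    obtain c where "\<exists>j\<in>J. c j \<noteq> 0" "\<forall>i<n. (\<Sum>j\<in>J. c j * y j i) = 0"
      using Suc.IH[of J y] Suc.prems by auto
    then show ?thesis using False by (intro exI[of _ c]) (auto simp: less_Suc_eq)
  next
    case True
    then obtain j0 where j0: "j0 \<in> J" "y j0 n \<noteq> 0" by blast
    define J' where "J' = J - {j0}"
    have J': "finite J'" "j0 \<notin> J'" "J = insert j0 J'" using j0 Suc.prems by (auto simp: J'_def)
    then have "card J' > n" using Suc.prems by simp
    then obtain c where c: "\<exists>j\<in>J'. c j \<noteq> 0"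
      "\<forall>i<n. (\<Sum>j\<in>J'. c j * (y j i - y j n / y j0 n * y j0 i)) = 0"
      using Suc.IH[of J' "\<lambda>j i. y j i - y j n / y j0 n * y j0 i"] J'(1) by auto
    define c' where "c' = c(j0 := - (\<Sum>j\<in>J'. c j * y j n / y j0 n))"
    have eq: "(\<Sum>j\<in>J. c' j * y j i) = (\<Sum>j\<in>J'. c j * (y j i - y j n / y j0 n * y j0 i))" for i
    proof -
      have "(\<Sum>j\<in>J'. c' j * y j i) = (\<Sum>j\<in>J'. c j * y j i)"
        using J' by (intro sum.cong) (auto simp: c'_def)
      then have "(\<Sum>j\<in>J. c' j * y j i)
          = (\<Sum>j\<in>J'. c j * y j i) - (\<Sum>j\<in>J'. c j * y j n / y j0 n) * y j0 i"
        using J' by (simp add: c'_def)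
      then show ?thesis by (simp add: right_diff_distrib sum_subtractf sum_distrib_right mult.assoc)
    qed
    have "(\<Sum>j\<in>J. c' j * y j i) = 0" if "i < Suc n" for i
    proof (cases "i = n")
      case True
      then show ?thesis unfolding eq using j0 by simp
    next
      case False
      then show ?thesis unfolding eq using c that by simp
    qed
    moreover have "\<exists>j\<in>J. c' j \<noteq> 0" using c(1) J' by (auto simp: c'_def)
    ultimately show ?thesis by blast
  qed
qed

text \<open>
  Homogeneous coordinates, with the constant \<open>1\<close> in place \<open>d\<close>, turn affine dependence into linear
  dependence of vectors with \<open>d + 1\<close> entries.
\<close>

lemma affine_dependence_of_points:
  fixes x :: "'j \<Rightarrow> (nat \<Rightarrow>\<^sub>0 real)"
  assumes "finite J" "card J > d + 1"
  obtains c where "\<exists>j\<in>J. c j > 0" "\<And>f. f \<in> affine_functionals d \<Longrightarrow> (\<Sum>j\<in>J. c j * f (x j)) = 0"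
proof -
  obtain c where c: "\<exists>j\<in>J. c j \<noteq> 0"
    and dep: "\<forall>i<d + 1. (\<Sum>j\<in>J. c j * (if i < d then Poly_Mapping.lookup (x j) i else 1)) = 0"
    using linear_dependence[OF assms, of "\<lambda>j i. if i < d then Poly_Mapping.lookup (x j) i else 1"]
    by blast
  have one: "(\<Sum>j\<in>J. c j) = 0" using spec[OF dep, of d] by simp
  have coord: "(\<Sum>j\<in>J. c j * Poly_Mapping.lookup (x j) i) = 0" if "i < d" for i
    using spec[OF dep, of i] that by simp
  have all: "(\<Sum>j\<in>J. c j * f (x j)) = 0" if "f \<in> affine_functionals d" for f
  proof -
    obtain a b where f: "f = (\<lambda>x. b + (\<Sum>l<d. a l * Poly_Mapping.lookup x l))"
      using \<open>f \<in> affine_functionals d\<close> by (auto simp: affine_functionals_def)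
    have "(\<Sum>j\<in>J. c j * f (x j))
        = b * (\<Sum>j\<in>J. c j) + (\<Sum>j\<in>J. \<Sum>l<d. a l * (c j * Poly_Mapping.lookup (x j) l))"
      by (simp add: f distrib_left sum.distrib sum_distrib_left mult.commute mult.left_commute)
    also have "\<dots> = b * (\<Sum>j\<in>J. c j) + (\<Sum>l<d. a l * (\<Sum>j\<in>J. c j * Poly_Mapping.lookup (x j) l))"
      by (subst sum.swap) (simp add: sum_distrib_left)
    finally show ?thesis using one coord by simp
  qed
  show thesis
  proof (cases "\<exists>j\<in>J. c j > 0")
    case True
    then show ?thesis using all by (rule that)
  next
    case False
    then have "\<exists>j\<in>J. - c j > 0" using c by (metis neg_0_less_iff_less linorder_neqE)
    moreover have "(\<Sum>j\<in>J. - c j * f (x j)) = 0" if "f \<in> affine_functionals d" for f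
      using all[OF that] by (simp add: sum_negf)
    ultimately show ?thesis by (rule that)
  qed
qed

definition halfspace_traces :: "nat \<Rightarrow> ('j \<Rightarrow> (nat \<Rightarrow>\<^sub>0 real)) \<Rightarrow> 'j set \<Rightarrow> 'j set set" where
  "halfspace_traces d x X = {{j \<in> X. f (x j) \<le> 0} |f. f \<in> affine_functionals d}"

text \<open>
  A set of more than \<open>d + 1\<close> points is not shattered: given an affine dependence \<open>c\<close>, a functional \<open>f\<close>
  that is nonpositive exactly where \<open>c\<close> is would make all products \<open>c j * f (x j)\<close> nonnegative and
  one of them positive, although they sum to zero.
\<close>

lemma card_halfspace_traces_le:
  assumes "finite X"
  shows "card (halfspace_traces d x X) \<le> (card X + 1) ^ (d + 1)"
proof (rule sauer_shelah[OF assms])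
  show "halfspace_traces d x X \<subseteq> Pow X" by (auto simp: halfspace_traces_def)
  fix J assume J: "J \<subseteq> X" "shatters (halfspace_traces d x X) J"
  show "card J \<le> d + 1"
  proof (rule ccontr)
    assume "\<not> card J \<le> d + 1"
    then have "card J > d + 1" "finite J" using J assms finite_subset by auto
    then obtain c where c: "\<exists>j\<in>J. c j > 0"
      "\<And>f. f \<in> affine_functionals d \<Longrightarrow> (\<Sum>j\<in>J. c j * f (x j)) = 0"
      using affine_dependence_of_points by metis
    have "{j \<in> J. c j \<le> 0} \<subseteq> J" by blast
    then have "\<exists>A\<in>halfspace_traces d x X. A \<inter> J = {j \<in> J. c j \<le> 0}"
      using J(2) unfolding shatters_def by blast
    then obtain f where f: "f \<in> affine_functionals d"
      and A: "{j \<in> X. f (x j) \<le> 0} \<inter> J = {j \<in> J. c j \<le> 0}"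
      unfolding halfspace_traces_def by blast
    have sgn: "f (x j) \<le> 0 \<longleftrightarrow> c j \<le> 0" if "j \<in> J" for j using A J(1) that by blast
    obtain j0 where j0: "j0 \<in> J" "c j0 > 0" using c(1) by blast
    have "(\<Sum>j\<in>J. c j * f (x j)) > 0"
    proof (rule sum_pos2[OF \<open>finite J\<close> j0(1)])
      show "c j0 * f (x j0) > 0" using sgn[OF j0(1)] j0 by simp
      show "c j * f (x j) \<ge> 0" if "j \<in> J" for j
        using sgn[OF that] by (cases "c j \<le> 0") (auto simp: mult_nonpos_nonpos)
    qed
    then show False using c(2)[OF f] by simp
  qed
qed

section \<open>Random assignments\<close>

lemma exp_minus_le_quadratic:
  fixes s :: real
  assumes "s \<ge> 0"
  shows "exp (- s) \<le> 1 - s + s\<^sup>2 / 2"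
proof -
  have "(1 + s + s\<^sup>2 / 2) * (1 - s + s\<^sup>2 / 2) = 1 + (s\<^sup>2)\<^sup>2 / 4"
    by (simp add: power2_eq_square field_simps)
  then have *: "1 \<le> (1 + s + s\<^sup>2 / 2) * (1 - s + s\<^sup>2 / 2)" by simp
  have "(1 - s + s\<^sup>2 / 2) * 2 = (1 - s)\<^sup>2 + 1" by (simp add: power2_eq_square field_simps)
  then have "1 - s + s\<^sup>2 / 2 \<ge> 0" by (smt (verit) zero_le_power2)
  then have "(1 + s + s\<^sup>2 / 2) * (1 - s + s\<^sup>2 / 2) \<le> exp s * (1 - s + s\<^sup>2 / 2)"
    using exp_lower_Taylor_quadratic[OF assms] by (rule mult_right_mono[rotated])
  with * have "1 \<le> exp s * (1 - s + s\<^sup>2 / 2)" by linarith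
  then have "exp (- s) * 1 \<le> exp (- s) * (exp s * (1 - s + s\<^sup>2 / 2))"
    by (intro mult_left_mono) auto
  then show ?thesis by (simp flip: mult.assoc exp_add)
qed

text \<open>
  The moment generating function of the number of places where a random function agrees with \<open>\<psi>\<close>. It
  factors because the values at different places are independent.
\<close>

lemma sum_agreements_generating_function:
  fixes z :: real
  assumes "finite X" "finite Y" "\<And>j. j \<in> X \<Longrightarrow> \<psi> j \<in> Y"
  shows "(\<Sum>\<phi>\<in>X \<rightarrow>\<^sub>E Y. z ^ card {j \<in> X. \<phi> j = \<psi> j}) = (real (card Y) - 1 + z) ^ card X"
proof -
  have "(\<Sum>\<phi>\<in>X \<rightarrow>\<^sub>E Y. z ^ card {j \<in> X. \<phi> j = \<psi> j})
      = (\<Sum>\<phi>\<in>X \<rightarrow>\<^sub>E Y. \<Prod>j\<in>X. if \<phi> j = \<psi> j then z else 1)"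
    using assms(1) by (simp add: prod.If_cases Collect_conj_eq)
  also have "\<dots> = (\<Prod>j\<in>X. \<Sum>i\<in>Y. if i = \<psi> j then z else 1)"
    using assms by (subst prod_sum_PiE) auto
  also have "\<dots> = (\<Prod>j\<in>X. real (card Y) - 1 + z)"
  proof (intro prod.cong refl)
    fix j assume "j \<in> X"
    then have j: "\<psi> j \<in> Y" using assms by simp
    have "(\<Sum>i\<in>Y. if i = \<psi> j then z else 1) = z + (\<Sum>i\<in>Y - {\<psi> j}. 1)"
      using assms j by (subst sum.remove[of _ "\<psi> j"]) (auto intro!: sum.cong)
    also have "card Y \<ge> 1" using j assms(2) by (metis One_nat_def Suc_leI card_gt_0_iff empty_iff)
    then have "z + (\<Sum>i\<in>Y - {\<psi> j}. 1) = real (card Y) - 1 + z"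
      using assms(2) j by (simp add: of_nat_diff)
    finally show "(\<Sum>i\<in>Y. if i = \<psi> j then z else 1) = real (card Y) - 1 + z" .
  qed
  finally show ?thesis by simp
qed

text \<open>
  The lower tail of a binomial variable with mean \<open>t + M\<close>, as a counting statement: Markov's
  inequality for \<open>z\<close> to the number of agreements, with \<open>z = exp (- s)\<close>. The choice \<open>s = M / (t + M)\<close>
  minimises the exponent \<open>- (s - s\<^sup>2/2) (t + M) + s t\<close>.
\<close>

lemma card_few_agreements_le:
  fixes M t :: nat
  assumes "finite X" "finite Y" "\<And>j. j \<in> X \<Longrightarrow> \<psi> j \<in> Y" "Y \<noteq> {}" "M > 0"
    and X: "card X = card Y * (t + M)"
  shows "real (card {\<phi> \<in> X \<rightarrow>\<^sub>E Y. card {j \<in> X. \<phi> j = \<psi> j} \<le> t})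
    \<le> real (card Y) ^ card X * exp (- (real M)\<^sup>2 / (2 * real (t + M)))"
proof -
  define B where "B = {\<phi> \<in> X \<rightarrow>\<^sub>E Y. card {j \<in> X. \<phi> j = \<psi> j} \<le> t}"
  define s where "s = real M / real (t + M)"
  define z where "z = exp (- s)"
  have s0: "s \<ge> 0" by (simp add: s_def)
  have z: "0 < z" "z \<le> 1" using s0 by (auto simp: z_def)
  have r: "real (card Y) \<ge> 1"
    using assms by (simp add: Suc_leI card_gt_0_iff)
  have fin: "finite (X \<rightarrow>\<^sub>E Y)" using assms by (intro finite_PiE) auto
  have "real (card B) * z ^ t = (\<Sum>\<phi>\<in>B. z ^ t)" by simp
  also have "\<dots> \<le> (\<Sum>\<phi>\<in>B. z ^ card {j \<in> X. \<phi> j = \<psi> j})"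
    using z by (intro sum_mono power_decreasing) (auto simp: B_def)
  also have "\<dots> \<le> (\<Sum>\<phi>\<in>X \<rightarrow>\<^sub>E Y. z ^ card {j \<in> X. \<phi> j = \<psi> j})"
    using fin z by (intro sum_mono2) (auto simp: B_def)
  also have "\<dots> = (real (card Y) - 1 + z) ^ card X"
    using assms by (intro sum_agreements_generating_function) auto
  also have "real (card Y) - 1 + z = real (card Y) * (1 - (1 - z) / real (card Y))"
    using r by (simp add: field_simps)
  also have "\<dots> ^ card X \<le> (real (card Y) * exp (- (1 - z) / real (card Y))) ^ card X"
  proof (intro power_mono mult_left_mono)
    show "1 - (1 - z) / real (card Y) \<le> exp (- (1 - z) / real (card Y))"
      using exp_ge_add_one_self[of "- (1 - z) / real (card Y)"]
      by (simp only: minus_divide_left[symmetric] add_uminus_conv_diff)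
    have "(1 - z) / real (card Y) \<le> 1" using z r by (simp add: field_simps)
    then show "real (card Y) * (1 - (1 - z) / real (card Y)) \<ge> 0"
      using r by (intro mult_nonneg_nonneg) auto
  qed simp
  also have "\<dots> = real (card Y) ^ card X * exp (- (1 - z) * real (t + M))"
  proof -
    have "real (card X) * (- (1 - z) / real (card Y)) = - (1 - z) * real (t + M)"
      unfolding X of_nat_mult using r by (simp add: field_simps)
    then show ?thesis by (simp only: power_mult_distrib flip: exp_of_nat_mult)
  qed
  finally have *: "real (card B) * z ^ t \<le> real (card Y) ^ card X * exp (- (1 - z) * real (t + M))" .
  have zt: "z ^ t = exp (- s * real t)"
    by (simp add: z_def mult.commute flip: exp_of_nat_mult)
  have "real (card B) = (real (card B) * z ^ t) * exp (s * real t)"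
    unfolding zt by (simp add: mult.assoc flip: exp_add)
  also have "\<dots> \<le> (real (card Y) ^ card X * exp (- (1 - z) * real (t + M))) * exp (s * real t)"
    by (intro mult_right_mono *) simp
  also have "\<dots> = real (card Y) ^ card X * exp (- (1 - z) * real (t + M) + s * real t)"
    by (simp only: exp_add mult.assoc)
  also have "\<dots> \<le> real (card Y) ^ card X * exp (- (real M)\<^sup>2 / (2 * real (t + M)))"
  proof -
    have "- (1 - z) * real (t + M) \<le> - (s - s\<^sup>2 / 2) * real (t + M)"
      using exp_minus_le_quadratic[OF s0] by (intro mult_right_mono) (auto simp: z_def)
    moreover have "- (s - s\<^sup>2 / 2) * real (t + M) + s * real t
        = - (real M)\<^sup>2 / (2 * real (t + M))"
    proof -
      have ne: "real (t + M) \<noteq> 0" using \<open>M > 0\<close> by simp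
      have sT: "s * real (t + M) = real M" using ne by (simp add: s_def)
      then have st: "s * real t = real M - s * real M" by (simp add: distrib_left)
      have "- (s - s\<^sup>2 / 2) * real (t + M) + s * real t
          = - (s * real (t + M)) + s * (s * real (t + M)) / 2 + s * real t"
        by (simp add: power2_eq_square left_diff_distrib)
      also have "\<dots> = - s * real M / 2" unfolding sT st by simp
      finally have "- (s - s\<^sup>2 / 2) * real (t + M) + s * real t = - s * real M / 2" .
      then show ?thesis by (simp add: s_def power2_eq_square)
    qed
    ultimately show ?thesis by (intro mult_left_mono) auto
  qed
  finally show ?thesis by (simp add: B_def)
qed

text \<open>
  The union bound. For \<open>S \<in> H\<close> a selector \<open>\<psi>\<close> with \<open>j \<in> S (\<psi> j)\<close> is fixed. The number of \<open>j\<close> with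
  \<open>j \<in> S (\<phi> j)\<close> is then at least the number of agreements of \<open>\<phi>\<close> and \<open>\<psi>\<close>.
\<close>

lemma exists_evenly_hitting_assignment:
  fixes M t :: nat
  assumes X: "finite X" "card X = card Y * (t + M)" and Y: "finite Y" "Y \<noteq> {}" and M: "M > 0"
    and H: "finite H" "\<And>S j. S \<in> H \<Longrightarrow> j \<in> X \<Longrightarrow> \<exists>i\<in>Y. j \<in> S i"
    and small: "real (card H) < exp ((real M)\<^sup>2 / (2 * real (t + M)))"
  obtains \<phi> where "\<phi> \<in> X \<rightarrow>\<^sub>E Y" "\<And>S. S \<in> H \<Longrightarrow> card {j \<in> X. j \<in> S (\<phi> j)} > t"
proof -
  define Bad where "Bad S = {\<phi> \<in> X \<rightarrow>\<^sub>E Y. card {j \<in> X. j \<in> S (\<phi> j)} \<le> t}" for S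
  define e where "e = exp ((real M)\<^sup>2 / (2 * real (t + M)))"
  have e: "e > 0" by (simp add: e_def)
  have fin: "finite (X \<rightarrow>\<^sub>E Y)" using X Y by (intro finite_PiE) auto
  have card_Bad: "real (card (Bad S)) \<le> real (card Y) ^ card X / e" if S: "S \<in> H" for S
  proof -
    obtain \<psi> where \<psi>: "\<And>j. j \<in> X \<Longrightarrow> \<psi> j \<in> Y \<and> j \<in> S (\<psi> j)"
      using H(2)[OF S] by metis
    have "Bad S \<subseteq> {\<phi> \<in> X \<rightarrow>\<^sub>E Y. card {j \<in> X. \<phi> j = \<psi> j} \<le> t}"
    proof
      fix \<phi> assume \<phi>: "\<phi> \<in> Bad S"
      have "card {j \<in> X. \<phi> j = \<psi> j} \<le> card {j \<in> X. j \<in> S (\<phi> j)}"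
        using X \<psi> by (intro card_mono) auto
      then show "\<phi> \<in> {\<phi> \<in> X \<rightarrow>\<^sub>E Y. card {j \<in> X. \<phi> j = \<psi> j} \<le> t}"
        using \<phi> by (auto simp: Bad_def)
    qed
    then have "real (card (Bad S)) \<le> real (card {\<phi> \<in> X \<rightarrow>\<^sub>E Y. card {j \<in> X. \<phi> j = \<psi> j} \<le> t})"
      using fin by (simp add: card_mono)
    also have "\<dots> \<le> real (card Y) ^ card X * exp (- (real M)\<^sup>2 / (2 * real (t + M)))"
      using X Y M \<psi> by (intro card_few_agreements_le) auto
    finally show ?thesis by (simp add: e_def exp_minus field_simps)
  qed
  have "real (card (\<Union>S\<in>H. Bad S)) \<le> (\<Sum>S\<in>H. real (card (Bad S)))"
    using card_UN_le[OF H(1), of Bad] by (simp flip: of_nat_sum)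
  also have "\<dots> \<le> real (card H) * (real (card Y) ^ card X / e)"
    using card_Bad by (intro sum_bounded_above) auto
  also have "\<dots> < e * (real (card Y) ^ card X / e)"
    using small e Y by (intro mult_strict_right_mono) (auto simp: e_def card_gt_0_iff)
  also have "\<dots> = real (card (X \<rightarrow>\<^sub>E Y))" using e X by (simp add: card_PiE)
  finally have "card (\<Union>S\<in>H. Bad S) < card (X \<rightarrow>\<^sub>E Y)" by simp
  then have "\<not> (X \<rightarrow>\<^sub>E Y) \<subseteq> (\<Union>S\<in>H. Bad S)"
    using H(1) fin by (metis (no_types, lifting) Bad_def card_mono finite_UN finite_subset linorder_not_le mem_Collect_eq subsetI)
  then obtain \<phi> where "\<phi> \<in> X \<rightarrow>\<^sub>E Y" "\<phi> \<notin> (\<Union>S\<in>H. Bad S)" by blast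
  then show thesis by (intro that[of \<phi>]) (auto simp: Bad_def not_le)
qed

section \<open>Tolerant partitions\<close>

text \<open>
  The family \<open>H\<close> collects the tuples of halfspace traces that cover all indices. Traces of a tuple of
  functionals with sum zero cover, so a random assignment has more than \<open>t\<close> blockers for each
  separating tuple. The points which block the tuple separating the remainders of the parts must all
  have been removed, and they are too many.
\<close>

lemma tolerant_numberI:
  fixes M t :: nat
  assumes r: "r > 0" and M: "M > 0"
    and small: "((real (r * (t + M)) + 1) ^ (d + 1)) ^ r < exp ((real M)\<^sup>2 / (2 * real (t + M)))"
  shows "tolerant_number t d r k (r * (t + M))"
  unfolding tolerant_number_def
proof (intro allI impI)
  fix x :: "nat \<Rightarrow> (nat \<Rightarrow>\<^sub>0 real)"
  define N where "N = r * (t + M)"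
  assume "\<forall>j<r * (t + M). x j \<in> Rd d"
  then have x: "x j \<in> Rd d" if "j < N" for j using that by (simp add: N_def)
  define H where "H = {S \<in> {1..r} \<rightarrow>\<^sub>E halfspace_traces d x {..<N}. \<forall>j<N. \<exists>i\<in>{1..r}. j \<in> S i}"
  have fin_traces: "finite (halfspace_traces d x {..<N})"
    by (rule finite_subset[of _ "Pow {..<N}"]) (auto simp: halfspace_traces_def)
  then have fin_PiE: "finite ({1..r} \<rightarrow>\<^sub>E halfspace_traces d x {..<N})"
    by (intro finite_PiE) auto
  have "card H \<le> card ({1..r} \<rightarrow>\<^sub>E halfspace_traces d x {..<N})"
    using fin_PiE by (intro card_mono) (auto simp: H_def)
  also have "\<dots> = card (halfspace_traces d x {..<N}) ^ r" by (simp add: card_PiE)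
  also have "\<dots> \<le> ((N + 1) ^ (d + 1)) ^ r"
    using card_halfspace_traces_le[of "{..<N}" d x] by (intro power_mono) auto
  finally have "real (card H) \<le> real (((N + 1) ^ (d + 1)) ^ r)" by (simp only: of_nat_le_iff)
  also have "real (((N + 1) ^ (d + 1)) ^ r) = ((real (r * (t + M)) + 1) ^ (d + 1)) ^ r"
    by (simp only: N_def of_nat_power of_nat_add of_nat_1)
  also note small
  finally have cH: "real (card H) < exp ((real M)\<^sup>2 / (2 * real (t + M)))" .
  obtain \<phi> where \<phi>: "\<phi> \<in> {..<N} \<rightarrow>\<^sub>E {1..r}"
    and hit: "\<And>S. S \<in> H \<Longrightarrow> card {j \<in> {..<N}. j \<in> S (\<phi> j)} > t"
  proof (rule exists_evenly_hitting_assignment[of "{..<N}" "{1..r}" t M H])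
    show "finite H" using fin_PiE by (simp add: H_def)
    show "\<exists>i\<in>{1..r}. j \<in> S i" if "S \<in> H" "j \<in> {..<N}" for S j using that by (auto simp: H_def)
  qed (use r M cH in \<open>auto simp: N_def\<close>)
  define P where "P i = {j. j < N \<and> \<phi> j = i}" for i
  have "(\<Inter>i\<in>I. convex hull (x ` (P i - C))) \<noteq> {}"
    if C: "C \<subseteq> {..<N}" "card C \<le> t" and I: "I \<subseteq> {1..r}" for C I
  proof
    assume "(\<Inter>i\<in>I. convex hull (x ` (P i - C))) = {}"
    \<comment> \<open>All \<open>r\<close> hulls are separated at once, not only those indexed by \<open>I\<close>.\<close>
    then have disj: "(\<Inter>i\<in>{1..r}. convex hull (x ` (P i - C))) = {}" using I by blast
    obtain F where F: "\<And>i. i \<in> {1..r} \<Longrightarrow> F i \<in> affine_functionals d"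
      "\<And>x. (\<Sum>i\<in>{1..r}. F i x) = 0"
      "\<And>i y. i \<in> {1..r} \<Longrightarrow> y \<in> x ` (P i - C) \<Longrightarrow> F i y > 0"
    proof (rule disjoint_hulls_separation[of "{1..r}" "\<lambda>i. x ` (P i - C)" d])
      show "finite (x ` (P i - C)) \<and> x ` (P i - C) \<subseteq> Rd d" for i
        using x by (auto simp: P_def)
    qed (use r disj in auto)
    define S where "S = (\<lambda>i\<in>{1..r}. {j \<in> {..<N}. F i (x j) \<le> 0})"
    have "\<exists>i\<in>{1..r}. F i y \<le> 0" for y
    proof (rule ccontr)
      assume "\<not> (\<exists>i\<in>{1..r}. F i y \<le> 0)"
      then have "(\<Sum>i\<in>{1..r}. F i y) > 0" using r by (intro sum_pos) (auto simp: not_le)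
      then show False using F(2) by simp
    qed
    then have "S \<in> H" unfolding H_def S_def using F(1) by (force simp: halfspace_traces_def)
    then have "t < card {j \<in> {..<N}. j \<in> S (\<phi> j)}" by (rule hit)
    also have "\<dots> \<le> card C"
    proof (rule card_mono)
      show "finite C" using C finite_subset by blast
      show "{j \<in> {..<N}. j \<in> S (\<phi> j)} \<subseteq> C"
      proof (rule subsetI, rule ccontr)
        fix j assume j: "j \<in> {j \<in> {..<N}. j \<in> S (\<phi> j)}" "j \<notin> C"
        then have i: "\<phi> j \<in> {1..r}" using \<phi> by blast
        then have "F (\<phi> j) (x j) > 0" using j by (intro F(3)) (auto simp: P_def)
        then show False using j i by (auto simp: S_def)
      qed
    qed
    finally show False using C by simp
  qed
  moreover have "disjoint_family_on P {1..r}" by (auto simp: disjoint_family_on_def P_def)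
  moreover have "(\<Union>i\<in>{1..r}. P i) = {..<N}" using \<phi> by (auto simp: P_def)
  ultimately show "\<exists>P. tolerant_partition t r k (r * (t + M)) x P"
    unfolding tolerant_partition_def N_def by (intro exI[of _ P]) blast
qed

text \<open>
  Removing all points of a part with at most \<open>t\<close> points leaves an empty hull, wherever the points are.
The configuration with all points at the origin serves as the example.
\<close>

lemma tolerant_number_ge:
  assumes "tolerant_number t d r k N" "k > 0" "r \<ge> k"
  shows "N \<ge> r * t"
proof -
  have "\<forall>j<N. (0 :: nat \<Rightarrow>\<^sub>0 real) \<in> Rd d" by (simp add: Rd_def)
  then obtain P where P: "tolerant_partition t r k N (\<lambda>_. 0 :: nat \<Rightarrow>\<^sub>0 real) P"
    using assms(1) unfolding tolerant_number_def by (elim allE[of _ "\<lambda>_. 0"]) blast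
  then have part: "disjoint_family_on P {1..r}" "(\<Union>i\<in>{1..r}. P i) = {..<N}"
    and tol: "\<And>C I. C \<subseteq> {..<N} \<Longrightarrow> card C \<le> t \<Longrightarrow> I \<subseteq> {1..r} \<Longrightarrow> card I = k \<Longrightarrow>
      (\<Inter>i\<in>I. convex hull ((\<lambda>_. 0 :: nat \<Rightarrow>\<^sub>0 real) ` (P i - C))) \<noteq> {}"
    unfolding tolerant_partition_def by blast+
  have sub: "P i \<subseteq> {..<N}" if "i \<in> {1..r}" for i using part(2) that by blast
  have "card (P i) \<ge> t" if i: "i \<in> {1..r}" for i
  proof (rule ccontr)
    assume "\<not> card (P i) \<ge> t"
    moreover obtain I where I: "{i} \<subseteq> I" "I \<subseteq> {1..r}" "card I = k"
      using exists_subset_between[of "{i}" k "{1..r}"] i assms by auto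
    ultimately have "(\<Inter>j\<in>I. convex hull ((\<lambda>_. 0 :: nat \<Rightarrow>\<^sub>0 real) ` (P j - P i))) \<noteq> {}"
      using sub[OF i] by (intro tol) auto
    then show False using I by auto
  qed
  then have "r * t \<le> (\<Sum>i\<in>{1..r}. card (P i))"
    using sum_bounded_below[of "{1..r}" t "\<lambda>i. card (P i)"] by simp
  also have "\<dots> = card (\<Union>i\<in>{1..r}. P i)"
    using part sub finite_subset
    by (intro card_UN_disjoint[symmetric]) (auto simp: disjoint_family_on_def intro: finite_subset[OF sub])
  also have "\<dots> = N" using part by simp
  finally show ?thesis .
qed

text \<open>
  It remains to choose \<open>M\<close> with \<open>r (d + 1) ln (N + 1) < M\<^sup>2 / (2 (t + M))\<close>. Since \<open>N + 1 \<le> Q\<^sup>7\<close>, the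
  left side is at most \<open>L / 2\<close> with \<open>L = 28 r d l\<close>, so that \<open>L t + L M < M\<^sup>2\<close> suffices. This holds
  when \<open>M > L + sqrt (L t)\<close>.
\<close>

lemma tolerant_number_upper_bound:
  fixes t d r k :: nat
  assumes pos: "t > 0" "d > 0" "r > 0" "k > 0"
  defines "l \<equiv> ln (2 + real t + real d + real r + real k)"
  obtains N where "tolerant_number t d r k N"
    "real N \<le> real r * real t + 29 * (real r * sqrt (real d * real k * real r * real t)
      + (real r)\<^sup>2 * real d * real k) * l"
proof -
  define Q where "Q = 2 + real t + real d + real r + real k"
  have Q: "Q \<ge> 6" using pos by (simp add: Q_def)
  have le_Q: "real t \<le> Q" "real d \<le> Q" "real r \<le> Q" by (auto simp: Q_def)
  have l: "l = ln Q" by (simp add: l_def Q_def)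
  have "exp (1::real) \<le> Q" using exp_le Q by linarith
  then have l1: "l \<ge> 1" unfolding l using Q by (subst ln_ge_iff) auto
  have lQ: "l \<le> Q" unfolding l using ln_le_minus_one[of Q] Q by simp
  define L where "L = 28 * real r * real d * l"
  have "1 \<le> real r * real d" using pos
    by (metis One_nat_def Suc_leI nat_0_less_mult_iff of_nat_1 of_nat_le_iff of_nat_mult)
  then have rdl: "1 \<le> real r * real d * l" using l1 mult_mono[of 1 "real r * real d" 1 l] by simp
  have L0: "L \<ge> 0" using rdl by (simp add: L_def mult.assoc)
  define M where "M = nat \<lfloor>L + sqrt (L * real t)\<rfloor> + 1"
  have A0: "L + sqrt (L * real t) \<ge> 0" using L0 by simp
  have M_gt: "real M > L + sqrt (L * real t)" and M_le: "real M \<le> L + sqrt (L * real t) + 1"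
    unfolding M_def using A0 by linarith+
  have rdlQ: "real r * real d * l \<le> Q ^ 3"
  proof -
    have "real r * real d * l \<le> Q * Q * Q"
      using le_Q lQ l1 Q by (intro mult_mono) auto
    then show ?thesis by (simp add: power3_eq_cube)
  qed
  have QQ: "36 \<le> Q ^ 2" using power_mono[OF Q, of 2] by simp
  have L_Q: "L \<le> Q ^ 5"
  proof -
    have "L \<le> Q ^ 2 * Q ^ 3" unfolding L_def mult.assoc
      using rdlQ QQ rdl by (intro mult_mono) (auto simp: mult.assoc)
    then show ?thesis by (simp flip: power_add)
  qed
  have sqrt_Q: "sqrt (L * real t) \<le> Q ^ 3"
  proof (rule real_le_lsqrt)
    have "L * real t \<le> Q ^ 5 * Q" using L_Q le_Q L0 Q by (intro mult_mono) auto
    then show "L * real t \<le> (Q ^ 3)\<^sup>2" by (simp flip: power_mult power_Suc2)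
  qed (use Q in auto)
  define N where "N = r * (t + M)"
  \<comment> \<open>A polynomial bound on \<open>N\<close> suffices, as only \<open>ln (N + 1)\<close> enters. The exponent \<open>7\<close> fixes the
     constant \<open>28 = 2 * 2 * 7\<close> in \<open>L\<close>.\<close>
  have "real N + 1 \<le> Q ^ 7"
  proof -
    have "real N + 1 \<le> Q * (Q + (Q ^ 5 + Q ^ 3 + 1)) + 1"
      unfolding N_def of_nat_mult of_nat_add
      using le_Q M_le L_Q sqrt_Q Q by (intro add_mono mult_mono) auto
    also have "\<dots> \<le> Q ^ 6 + Q ^ 6 + Q ^ 6 + Q ^ 6 + Q ^ 6"
    proof -
      have "Q ^ 1 \<le> Q ^ 6" "Q ^ 2 \<le> Q ^ 6" "Q ^ 4 \<le> Q ^ 6" "Q ^ 0 \<le> Q ^ 6"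
        using Q by (intro power_increasing; simp)+
      then show ?thesis by (simp add: algebra_simps power2_eq_square flip: power_Suc)
    qed
    also have "\<dots> \<le> Q * Q ^ 6" using mult_right_mono[OF Q, of "Q ^ 6"] Q by simp
    finally show ?thesis by (simp flip: power_Suc)
  qed
  then have "ln (real N + 1) \<le> ln (Q ^ 7)" using Q by (subst ln_le_cancel_iff) auto
  then have lnN: "ln (real N + 1) \<le> 7 * l" using Q by (simp add: ln_realpow l)
  have "exp (ln (real N + 1)) = real N + 1" by simp
  then have "((real N + 1) ^ (d + 1)) ^ r = exp (real r * (real (d + 1) * ln (real N + 1)))"
    by (simp only: exp_of_nat_mult)
  also have "real r * (real (d + 1) * ln (real N + 1)) \<le> real r * ((2 * real d) * (7 * l))"
    using pos lnN by (intro mult_left_mono mult_mono) auto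
  also have "real r * ((2 * real d) * (7 * l)) = L / 2" by (simp add: L_def)
  also have "L / 2 < (real M)\<^sup>2 / (2 * real (t + M))"
  proof -
    define q where "q = sqrt (L * real t)"
    have q: "q \<ge> 0" "q * q = L * real t" using L0 by (auto simp: q_def)
    have M': "real M > L + q" "real M > 0" using M_gt L0 q(1) unfolding q_def by linarith+
    have "L * real t + L * real M = q * q + L * real M" using q by simp
    also have "\<dots> \<le> q * real M + L * real M"
      using M' q L0 by (intro add_right_mono mult_left_mono) auto
    also have "\<dots> < real M * real M"
      using mult_strict_right_mono[OF M'(1,2)] by (simp add: algebra_simps)
    finally have "L * real (t + M) < (real M)\<^sup>2" by (simp add: power2_eq_square algebra_simps)
    then show ?thesis using M' by (simp add: field_simps)
  qed
  finally have "((real N + 1) ^ (d + 1)) ^ r < exp ((real M)\<^sup>2 / (2 * real (t + M)))" by simp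
  then have "tolerant_number t d r k N"
    unfolding N_def using pos by (intro tolerant_numberI) (auto simp: M_def)
  moreover have "real N \<le> real r * real t + 29 * (real r * sqrt (real d * real k * real r * real t)
      + (real r)\<^sup>2 * real d * real k) * l"
  proof -
    define W where "W = real d * real k * real r * real t"
    have k1: "real k \<ge> 1" using pos by simp
    have "sqrt (L * real t) \<le> 29 * sqrt W * l"
    proof (rule real_le_lsqrt)
      have "L * real t = 28 * (real d * real r * real t) * l" by (simp add: L_def)
      also have "\<dots> \<le> 29\<^sup>2 * W * l\<^sup>2"
      proof (intro mult_mono)
        show "real d * real r * real t \<le> W" unfolding W_def
          using mult_right_mono[OF k1, of "real d * real r * real t"] by (simp add: mult_ac)
        show "l \<le> l\<^sup>2" using l1 by (simp add: power2_eq_square)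
      qed (use l1 in \<open>auto simp: W_def\<close>)
      also have "\<dots> = (29 * sqrt W * l)\<^sup>2" by (simp add: power_mult_distrib W_def)
      finally show "L * real t \<le> (29 * sqrt W * l)\<^sup>2" .
    qed (use L0 l1 in \<open>auto simp: W_def\<close>)
    moreover have "L + 1 \<le> 29 * (real r * real d * real k) * l"
    proof -
      have "L = 28 * (real r * real d * l)" by (simp add: L_def mult.assoc)
      then have "L + 1 \<le> 29 * (real r * real d * l) * 1" using rdl by linarith
      also have "\<dots> \<le> 29 * (real r * real d * l) * real k"
        using k1 l1 by (intro mult_left_mono) auto
      finally show ?thesis by (simp add: mult_ac)
    qed
    ultimately have "real M \<le> 29 * (sqrt W + real r * real d * real k) * l"
      using M_le by (simp add: algebra_simps)
    then have "real r * real M \<le> real r * (29 * (sqrt W + real r * real d * real k) * l)"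
      by (intro mult_left_mono) auto
    then show ?thesis
      by (simp add: N_def W_def algebra_simps power2_eq_square)
  qed
  ultimately show thesis by (rule that)
qed

theorem theorem5p1:
  shows "\<exists>K m :: real. K > 0 \<and> m > 0 \<and>
    (\<forall>t d r k :: nat. t > 0 \<and> d > 0 \<and> r > 0 \<and> k > 0 \<and> r \<ge> k \<longrightarrow>
       (\<exists>N. tolerant_number t d r k N) \<and>
       \<bar>real (tolerant_R t d r k) - real r * real t\<bar>
         \<le> K * (real r * sqrt (real d * real k * real r * real t) + (real r)\<^sup>2 * real d * real k)
             * (ln (2 + real t + real d + real r + real k)) powr m)"
proof (rule exI[of _ 29], rule exI[of _ 1], intro conjI allI impI)
  fix t d r k :: nat
  assume *: "t > 0 \<and> d > 0 \<and> r > 0 \<and> k > 0 \<and> r \<ge> k"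
  let ?l = "ln (2 + real t + real d + real r + real k)"
  obtain N where N: "tolerant_number t d r k N"
    "real N \<le> real r * real t + 29 * (real r * sqrt (real d * real k * real r * real t)
      + (real r)\<^sup>2 * real d * real k) * ?l"
    using tolerant_number_upper_bound[of t d r k] * by blast
  show "\<exists>N. tolerant_number t d r k N" using N(1) by blast
  have "tolerant_number t d r k (tolerant_R t d r k)" "tolerant_R t d r k \<le> N"
    unfolding tolerant_R_def using N(1) by (auto intro: LeastI Least_le)
  then have "r * t \<le> tolerant_R t d r k" using tolerant_number_ge * by blast
  then have "real r * real t \<le> real (tolerant_R t d r k)"
    by (metis of_nat_le_iff of_nat_mult)
  moreover have "real (tolerant_R t d r k) \<le> real N" using \<open>tolerant_R t d r k \<le> N\<close> by simp
  moreover have "?l powr 1 = ?l" by (intro powr_one) (auto intro!: ln_ge_zero)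
  ultimately show "\<bar>real (tolerant_R t d r k) - real r * real t\<bar>
      \<le> 29 * (real r * sqrt (real d * real k * real r * real t) + (real r)\<^sup>2 * real d * real k)
          * ?l powr 1"
    using N(2) by simp
qed auto

end
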